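(* For all trees $T,T'\in\mathbb{T}$ and all $i,j\in\mathbb{N}$, there exists a bijection from $N'_{i,j}(T,T')$ to $\widetilde S'_{j,i}(T,T')$, where $$N'_{i,j}(T,T')=\{((T,T''),(T',T''))\in G_{U'_i}\times G_{D_j}\},$$ $$S'_{j,i}(T,T')=\{((T'',T),(T'',T'))\in G_{D_j}\times G_{U'_i}\},\qquad \widetilde S'_{j,i}(T,T')=\coprod_{k=0}^{\min(1,i,j)}S'_{j-k,i-k}(T,T')$$ ($T''$ ranging over $\mathbb{T}$, and $\coprod$ denoting disjoint union).
   Context: Trees. $\mathbb{N}=\{0,1,2,\ldots\}$. Let $F$ be the monoid of words in the alphabet $\{1,2\}$, with the empty word denoted $0$, partially ordered by $v\le vw$ for $v,w\in F$ (prefix order). A (rooted planar binary) tree is a finite order ideal of $F$, i.e. a finite, possibly empty, subset $T\subset F$ closed under taking prefixes; its elements are its nodes. $\mathbb{T}$ is the set of all trees, and $|T|$ is the number of nodes of $T$. For $v\in F$ put $T_v=\{w\in T: v\le w\}$. The graph $G_{U'_i}$. $G_{U'}$ is the set of pairs $(T,T')$ of trees with $T\subset T'$ such that: if $T\ne\emptyset$, each $w\in T'\setminus T$ can be written $w=v2^n$ or $w=v12^n$ for some $v\in T$ and some integer $n\ge 0$; if $T=\emptyset$, each $w\in T'\setminus T$ is of the form $2^n$, $n\ge 0$. $G_{U'_i}=\{(T,T')\in G_{U'}: |T|+i=|T'|\}$. The graph $G_{D_i}$. For a tree $T$ let $R_T=\{w\in T: w2\notin T\}$. For $w\in R_T$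 let $T\circleddash w=(T\setminus T_w)\cup\{wv: w1v\in T_w\}$ (delete $w$ and move its left subtree up into its place). Let $E_T$ be the set of $w\in T$ such that whenever $w=v1w'$ with $v,w'\in F$ one has $v2\notin T$. Let $r_T=E_T\cap R_T$; it is a chain $w_{T,1}<w_{T,2}<\cdots<w_{T,k}$. For $0\le i\le |r_T|$ put $r_{T,i}=\{w_{T,1},\ldots,w_{T,i}\}$, and define $T\ominus r_{T,i}$ inductively by $T\ominus r_{T,0}=T$ and $T\ominus r_{T,i}=(T\circleddash w_{T,i})\ominus r_{T,i-1}$ for $i>0$; that is, apply $\circleddash w_{T,i}$, then $\circleddash w_{T,i-1}$, ..., finally $\circleddash w_{T,1}$. $G_{D_i}=\{(T\ominus r_{T,i},T): T\in\mathbb{T},\ |r_T|\ge i\}$. *)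

theory Defs
  imports Main "HOL-Library.Sublist"
begin

datatype letter = L1 | L2

text \<open>The free monoid \<open>F\<close> is the type of lists of letters, its unit \<open>0\<close> is the empty
  list, and its partial order is the prefix order.\<close>

type_synonym word = "letter list"

definition tree :: "word set \<Rightarrow> bool" where
  "tree T \<longleftrightarrow> finite T \<and> (\<forall>v w. prefix v w \<longrightarrow> w \<in> T \<longrightarrow> v \<in> T)"

definition trees :: "word set set" where
  "trees = {T. tree T}"

definition subtree_at :: "word set \<Rightarrow> word \<Rightarrow> word set" where
  "subtree_at T v = {w \<in> T. prefix v w}"

definition G_U' :: "(word set \<times> word set) set" where
  "G_U' = {(T, T'). T \<in> trees \<and> T' \<in> trees \<and> T \<subseteq> T' \<and>
     (T \<noteq> {} \<longrightarrow> (\<forall>w \<in> T' - T. \<exists>v \<in> T. \<exists>n.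
        w = v @ replicate n L2 \<or> w = v @ [L1] @ replicate n L2)) \<and>
     (T = {} \<longrightarrow> (\<forall>w \<in> T' - T. \<exists>n. w = replicate n L2))}"

definition G_U'i :: "nat \<Rightarrow> (word set \<times> word set) set" where
  "G_U'i i = {(T, T'). (T, T') \<in> G_U' \<and> card T + i = card T'}"

definition R_set :: "word set \<Rightarrow> word set" where
  "R_set T = {w \<in> T. w @ [L2] \<notin> T}"

definition remove_node :: "word set \<Rightarrow> word \<Rightarrow> word set" where
  "remove_node T w = (T - subtree_at T w) \<union> {w @ v |v. w @ [L1] @ v \<in> subtree_at T w}"

definition E_set :: "word set \<Rightarrow> word set" where
  "E_set T = {w \<in> T. \<forall>v w'. w = v @ [L1] @ w' \<longrightarrow> v @ [L2] \<notin> T}"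

definition r_set :: "word set \<Rightarrow> word set" where
  "r_set T = E_set T \<inter> R_set T"

text \<open>The node \<open>w\<^sub>T\<^sub>,\<^sub>i\<close>, counted from \<open>i = 1\<close>. That \<open>r_set T\<close> is a chain, so that this
  is its increasing enumeration, is shown in \<open>r_set_chain\<close> and \<open>r_node_enumerates\<close>.\<close>

definition r_node :: "word set \<Rightarrow> nat \<Rightarrow> word" where
  "r_node T i = (THE w. w \<in> r_set T \<and> card {v \<in> r_set T. prefix v w} = i)"

text \<open>The nodes to be removed are those of the original tree: they are fixed before the
  first removal and not recomputed from the intermediate trees.\<close>

primrec remove_nodes :: "(nat \<Rightarrow> word) \<Rightarrow> nat \<Rightarrow> word set \<Rightarrow> word set" where
  "remove_nodes u 0 T = T"
| "remove_nodes u (Suc i) T = remove_nodes u i (remove_node T (u (Suc i)))"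

definition r_remove :: "word set \<Rightarrow> nat \<Rightarrow> word set" where
  "r_remove T i = remove_nodes (r_node T) i T"

definition G_D :: "nat \<Rightarrow> (word set \<times> word set) set" where
  "G_D i = {(r_remove T i, T) |T. T \<in> trees \<and> i \<le> card (r_set T)}"

definition N' :: "nat \<Rightarrow> nat \<Rightarrow> word set \<Rightarrow> word set
    \<Rightarrow> ((word set \<times> word set) \<times> (word set \<times> word set)) set" where
  "N' i j T T' = {((T, T''), (T', T'')) |T''. T'' \<in> trees \<and>
     ((T, T''), (T', T'')) \<in> G_U'i i \<times> G_D j}"

definition S' :: "nat \<Rightarrow> nat \<Rightarrow> word set \<Rightarrow> word set
    \<Rightarrow> ((word set \<times> word set) \<times> (word set \<times> word set)) set" where
  "S' j i T T' = {((T'', T), (T'', T')) |T''. T'' \<in> trees \<and>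
     ((T'', T), (T'', T')) \<in> G_D j \<times> G_U'i i}"

definition S'_tilde :: "nat \<Rightarrow> nat \<Rightarrow> word set \<Rightarrow> word set
    \<Rightarrow> (nat \<times> ((word set \<times> word set) \<times> (word set \<times> word set))) set" where
  "S'_tilde j i T T' = (SIGMA k : {0..min 1 (min i j)}. S' (j - k) (i - k) T T')"

lemma finite_r_set: "tree T \<Longrightarrow> finite (r_set T)"
  by (auto simp: tree_def r_set_def R_set_def)

lemma r_set_chain:
  assumes "tree T" "v \<in> r_set T" "w \<in> r_set T"
  shows "prefix v w \<or> prefix w v"
proof (rule ccontr)
  assume "\<not> ?thesis"
  then have "v \<parallel> w" by (auto simp: parallel_def)
  then obtain p a b vs ws where "a \<noteq> b" and v: "v = p @ a # vs" and w: "w = p @ b # ws"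
    using parallel_decomp by blast
  have in_T: "v \<in> T" "w \<in> T" and E: "v \<in> E_set T" "w \<in> E_set T"
    using assms by (auto simp: r_set_def E_set_def)
  have pre: "p @ [a] \<in> T" "p @ [b] \<in> T"
    using assms(1) in_T v w unfolding tree_def
    by (metis append.assoc append_Cons append_Nil prefixI)+
  show False
  proof (cases a)
    case L1
    then have "b = L2" using \<open>a \<noteq> b\<close> by (cases b) auto
    then show False using L1 E(1) v pre by (auto simp: E_set_def)
  next
    case L2
    then have "b = L1" using \<open>a \<noteq> b\<close> by (cases b) auto
    then show False using L2 E(2) w pre by (auto simp: E_set_def)
  qed
qed

lemma r_node_enumerates:
  assumes "tree T"
  shows "bij_betw (r_node T) {1..card (r_set T)} (r_set T)"
    and "\<And>i j. 1 \<le> i \<Longrightarrow> i < j \<Longrightarrow> j \<le> card (r_set T) \<Longrightarrow>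
           strict_prefix (r_node T i) (r_node T j)"
proof -
  define A where "A = r_set T"
  define rk where "rk w = card {v \<in> A. prefix v w}" for w
  have fin: "finite A" using finite_r_set[OF assms] by (simp add: A_def)
  have mono: "rk v < rk w" if "v \<in> A" "w \<in> A" "strict_prefix v w" for v w
    unfolding rk_def
  proof (rule psubset_card_mono)
    show "finite {x \<in> A. prefix x w}" using fin by simp
    show "{x \<in> A. prefix x v} \<subset> {x \<in> A. prefix x w}"
      using that by (auto simp: strict_prefix_def dest: prefix_order.antisym
          intro: prefix_order.trans)
  qed
  have total: "v = w \<or> strict_prefix v w \<or> strict_prefix w v" if "v \<in> A" "w \<in> A" for v w
    using r_set_chain[OF assms] that by (auto simp: A_def strict_prefix_def)
  have inj: "inj_on rk A"
    by (rule inj_onI) (metis mono total less_irrefl_nat)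
  have sub: "rk ` A \<subseteq> {1..card A}"
  proof clarify
    fix w assume w: "w \<in> A"
    have "{v \<in> A. prefix v w} \<noteq> {}" using w by auto
    then have "0 < rk w" unfolding rk_def using fin by (simp add: card_gt_0_iff)
    moreover have "rk w \<le> card A" unfolding rk_def using fin by (auto intro: card_mono)
    ultimately show "rk w \<in> {1..card A}" by simp
  qed
  have "rk ` A = {1..card A}"
    by (rule card_subset_eq) (use sub inj in \<open>auto simp: card_image\<close>)
  then have bij: "bij_betw rk A {1..card A}" using inj by (simp add: bij_betw_def)
  have inv: "r_node T (rk w) = w" if "w \<in> A" for w
  proof -
    have "r_node T (rk w) = (THE x. x \<in> A \<and> rk x = rk w)"
      by (simp add: r_node_def A_def rk_def)
    also have "\<dots> = w" using that inj by (auto simp: inj_on_def)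
    finally show ?thesis .
  qed
  have node: "r_node T i \<in> A \<and> rk (r_node T i) = i" if "i \<in> {1..card A}" for i
    using that bij inv unfolding bij_betw_def by (metis imageE)
  show "bij_betw (r_node T) {1..card (r_set T)} (r_set T)"
    unfolding A_def[symmetric]
    by (rule bij_betw_byWitness[where f' = rk]) (use node inv sub in auto)
  show "strict_prefix (r_node T i) (r_node T j)"
    if "1 \<le> i" "i < j" "j \<le> card (r_set T)" for i j
  proof -
    have "i \<in> {1..card A}" "j \<in> {1..card A}" using that by (auto simp: A_def)
    then show ?thesis using node that(2) total mono by (metis less_asym less_irrefl_nat)
  qed
qed

end

theory Submission
  imports Defs
begin

text \<open>Write a tree as empty or as a root with a left and a right subtree. Then a pair in
  \<open>G_U'\<close> consists in grafting a right comb onto each leaf position, and \<open>G_D j\<close> is the graph of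
  a partial map \<open>D\<^sub>j\<close>, which is the identity for \<open>j = 0\<close> and satisfies
  \<open>D\<^sub>j (l, r) = (l, D\<^sub>j r)\<close> for \<open>r \<noteq> 0\<close> and \<open>D\<^sub>j\<^sub>+\<^sub>1 (l, 0) = D\<^sub>j l\<close>. In particular
  \<open>S'\<close> has at most one element. Let \<open>n\<^sub>j t t'\<close> be the number of trees that arise from \<open>t\<close> by
  grafting combs and are sent to \<open>t'\<close> by \<open>D\<^sub>j\<close>, and let \<open>s\<^sub>j t t'\<close> be 1 if \<open>t'\<close> arises from
  \<open>D\<^sub>j t\<close> by grafting combs and 0 otherwise. The recursions give
  \<open>n\<^sub>j\<^sub>+\<^sub>1 t t' = s\<^sub>j\<^sub>+\<^sub>1 t t' + s\<^sub>j t t'\<close> by induction on \<open>t\<close>; the indices \<open>i\<close> merely record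
  numbers of nodes.\<close>

section \<open>Node sets of binary trees\<close>

datatype btree = Leaf | Node btree btree

definition join :: "word set \<Rightarrow> word set \<Rightarrow> word set" where
  "join A B = insert [] ((#) L1 ` A \<union> (#) L2 ` B)"

lemma mem_join [simp]:
  "[] \<in> join A B" "L1 # w \<in> join A B \<longleftrightarrow> w \<in> A" "L2 # w \<in> join A B \<longleftrightarrow> w \<in> B"
  by (auto simp: join_def)

lemma word_set_eqI:
  fixes A B :: "word set"
  assumes "[] \<in> A \<longleftrightarrow> [] \<in> B"
    and "\<And>w. L1 # w \<in> A \<longleftrightarrow> L1 # w \<in> B" and "\<And>w. L2 # w \<in> A \<longleftrightarrow> L2 # w \<in> B"
  shows "A = B"
proof (rule set_eqI)
  fix w :: word
  show "w \<in> A \<longleftrightarrow> w \<in> B"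
    using assms by (cases w; cases "hd w") auto
qed

lemma all_word_iff:
  fixes P :: "word \<Rightarrow> bool"
  shows "(\<forall>w. P w) \<longleftrightarrow> P [] \<and> (\<forall>w. P (L1 # w)) \<and> (\<forall>w. P (L2 # w))"
  by (metis letter.exhaust list.exhaust)

lemma join_eq_iff [simp]: "join A B = join A' B' \<longleftrightarrow> A = A' \<and> B = B'"
  by (metis mem_join(2,3) set_eqI)

lemma join_not_empty [simp]: "join A B \<noteq> {}" "{} \<noteq> join A B"
  by (auto simp: join_def)

primrec nodes :: "btree \<Rightarrow> word set" where
  "nodes Leaf = {}"
| "nodes (Node l r) = join (nodes l) (nodes r)"

lemma nodes_empty_iff [simp]: "nodes t = {} \<longleftrightarrow> t = Leaf" "{} = nodes t \<longleftrightarrow> t = Leaf"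
  by (cases t; simp)+

lemma Nil_in_nodes_iff [simp]: "[] \<in> nodes t \<longleftrightarrow> t \<noteq> Leaf"
  by (cases t) auto

lemma nodes_inject [simp]: "nodes t = nodes t' \<longleftrightarrow> t = t'"
proof (induction t arbitrary: t')
  case (Node l r)
  then show ?case by (cases t') auto
qed auto

lemma finite_nodes [simp]: "finite (nodes t)"
  by (induction t) (auto simp: join_def)

lemma card_nodes [simp]: "card (nodes t) = size t"
proof (induction t)
  case (Node l r)
  have "card (nodes (Node l r)) = Suc (card ((#) L1 ` nodes l \<union> (#) L2 ` nodes r))"
    by (subst nodes.simps, unfold join_def, subst card_insert_disjoint) auto
  also have "\<dots> = Suc (card (nodes l) + card (nodes r))"
    by (subst card_Un_disjoint) (auto simp: card_image)
  finally show ?case using Node.IH by simp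
qed simp

lemma tree_nodes: "tree (nodes t)"
proof -
  have "v \<in> nodes t" if "prefix v w" "w \<in> nodes t" for v w
    using that
  proof (induction t arbitrary: v w)
    case (Node l r)
    then show ?case
      by (cases v) (auto simp: join_def prefix_Cons)
  qed simp
  then show ?thesis by (auto simp: tree_def)
qed

lemma tree_eq_join:
  assumes "tree T" "T \<noteq> {}"
  shows "T = join {w. L1 # w \<in> T} {w. L2 # w \<in> T}"
proof (rule word_set_eqI)
  show "[] \<in> T \<longleftrightarrow> [] \<in> join {w. L1 # w \<in> T} {w. L2 # w \<in> T}"
    using assms by (auto simp: tree_def)
qed auto

lemma tree_imp_nodes: "tree T \<Longrightarrow> \<exists>t. T = nodes t"
proof (induction "card T" arbitrary: T rule: less_induct)
  case less
  show ?case
  proof (cases "T = {}")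
    case True
    then show ?thesis by (intro exI[of _ Leaf]) simp
  next
    case False
    have sub: "\<exists>t. {w. a # w \<in> T} = nodes t" for a
    proof (rule less.hyps)
      have fin: "finite T" using less.prems by (simp add: tree_def)
      \<comment> \<open>The branch at \<open>a\<close>, shifted back into \<open>T\<close>, misses
        the root \<open>[]\<close>, so it has fewer elements than \<open>T\<close>.\<close>
      have img: "(#) a ` {w. a # w \<in> T} \<subset> T"
        using False less.prems by (auto simp: tree_def)
      have "card {w. a # w \<in> T} = card ((#) a ` {w. a # w \<in> T})"
        by (simp add: card_image)
      also have "\<dots> < card T" by (rule psubset_card_mono[OF fin img])
      finally show "card {w. a # w \<in> T} < card T" .
      have "finite {w. a # w \<in> T}"
        using finite_vimageI[OF fin, of "(#) a"] by (simp add: vimage_def)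
      then show "tree {w. a # w \<in> T}"
        using less.prems by (auto simp: tree_def) (metis Cons_prefix_Cons)
    qed
    from sub[of L1] obtain l where "{w. L1 # w \<in> T} = nodes l" ..
    moreover from sub[of L2] obtain r where "{w. L2 # w \<in> T} = nodes r" ..
    ultimately have "T = nodes (Node l r)"
      using tree_eq_join[OF less.prems False] by simp
    then show ?thesis ..
  qed
qed

lemma trees_eq_range_nodes: "trees = range nodes"
  using tree_imp_nodes tree_nodes by (auto simp: trees_def)


subsection \<open>The graph \<open>G_U'\<close>\<close>

text \<open>These are the trees consisting of the words \<open>replicate n L2\<close> with
  \<open>n < m\<close>, for some \<open>m\<close>: exactly what may be grafted onto an empty
  position.\<close>

primrec right_comb :: "btree \<Rightarrow> bool" where
  "right_comb Leaf \<longleftrightarrow> True"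
| "right_comb (Node l r) \<longleftrightarrow> l = Leaf \<and> right_comb r"

primrec grafts :: "btree \<Rightarrow> btree \<Rightarrow> bool" where
  "grafts Leaf t' \<longleftrightarrow> right_comb t'"
| "grafts (Node l r) t' \<longleftrightarrow> (\<exists>l' r'. t' = Node l' r' \<and> grafts l l' \<and> grafts r r')"

text \<open>Both cases of \<open>G_U'\<close> in one predicate on a single word, so that the
  condition can be passed through \<open>join\<close> one letter at a time.\<close>

definition graftable :: "word set \<Rightarrow> word \<Rightarrow> bool" where
  "graftable T w \<longleftrightarrow> (if T = {} then \<exists>n. w = replicate n L2
     else \<exists>v\<in>T. \<exists>n. w = v @ replicate n L2 \<or> w = v @ [L1] @ replicate n L2)"

lemma G_U'_iff:
  "(T, T') \<in> G_U' \<longleftrightarrow>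
     T \<in> trees \<and> T' \<in> trees \<and> T \<subseteq> T' \<and> (\<forall>w\<in>T' - T. graftable T w)"
  by (cases "T = {}") (simp_all add: G_U'_def graftable_def)

lemma graftable_empty_Cons [simp]:
  "\<not> graftable {} (L1 # w)" "graftable {} (L2 # w) \<longleftrightarrow> graftable {} w"
  by (auto simp: graftable_def Cons_replicate_eq)

lemma graftable_empty_Nil [simp]: "graftable {} []"
  by (simp add: graftable_def)

text \<open>Besides grafting inside \<open>A\<close>, only grafting at the new root reaches this
  side, and it gives \<open>w = replicate n L2\<close>. For empty \<open>A\<close> these are the
  words allowed anyway; otherwise they are grafted at the root \<open>[]\<close> of
  \<open>A\<close>.\<close>

lemma graftable_join_L1:
  assumes "A = {} \<or> [] \<in> A"
  shows "graftable (join A B) (L1 # w) \<longleftrightarrow> graftable A w"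
proof
  assume "graftable (join A B) (L1 # w)"
  then obtain v n where v: "v \<in> join A B"
    and w: "L1 # w = v @ replicate n L2 \<or> L1 # w = v @ [L1] @ replicate n L2"
    by (auto simp: graftable_def)
  show "graftable A w"
  proof (cases v)
    case Nil
    then have "w = replicate n L2" using w by (auto simp: Cons_replicate_eq)
    then show ?thesis using assms by (auto simp: graftable_def)
  next
    case (Cons a u)
    then have "u \<in> A" "w = u @ replicate n L2 \<or> w = u @ [L1] @ replicate n L2"
      using v w by auto
    then show ?thesis by (auto simp: graftable_def)
  qed
next
  assume *: "graftable A w"
  show "graftable (join A B) (L1 # w)"
  proof (cases "A = {}")
    case True
    then obtain n where "L1 # w = [] @ [L1] @ replicate n L2"
      using * by (auto simp: graftable_def)
    then show ?thesis unfolding graftable_def by (metis join_not_empty(1) mem_join(1))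
  next
    case False
    then obtain v n where "v \<in> A" "w = v @ replicate n L2 \<or> w = v @ [L1] @ replicate n L2"
      using * by (auto simp: graftable_def)
    then have "L1 # v \<in> join A B"
      "L1 # w = (L1 # v) @ replicate n L2 \<or> L1 # w = (L1 # v) @ [L1] @ replicate n L2"
      by auto
    then show ?thesis unfolding graftable_def by (metis join_not_empty(1))
  qed
qed

lemma graftable_join_L2:
  assumes "B = {} \<or> [] \<in> B"
  shows "graftable (join A B) (L2 # w) \<longleftrightarrow> graftable B w"
proof
  assume "graftable (join A B) (L2 # w)"
  then obtain v n where v: "v \<in> join A B"
    and w: "L2 # w = v @ replicate n L2 \<or> L2 # w = v @ [L1] @ replicate n L2"
    by (auto simp: graftable_def)
  show "graftable B w"
  proof (cases v)
    case Nil
    \<comment> \<open>The leading \<open>L2\<close> uses up one of the \<open>n\<close> letters, so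
      \<open>n > 0\<close>; the second alternative would start with \<open>L1\<close>.\<close>
    then have "w = replicate (n - 1) L2" using w by (auto simp: Cons_replicate_eq)
    then show ?thesis using assms by (auto simp: graftable_def)
  next
    case (Cons a u)
    then have "u \<in> B" "w = u @ replicate n L2 \<or> w = u @ [L1] @ replicate n L2"
      using v w by auto
    then show ?thesis by (auto simp: graftable_def)
  qed
next
  assume *: "graftable B w"
  show "graftable (join A B) (L2 # w)"
  proof (cases "B = {}")
    case True
    then obtain n where "L2 # w = [] @ replicate (Suc n) L2"
      using * by (auto simp: graftable_def)
    then show ?thesis unfolding graftable_def by (metis join_not_empty(1) mem_join(1))
  next
    case False
    then obtain v n where "v \<in> B" "w = v @ replicate n L2 \<or> w = v @ [L1] @ replicate n L2"
      using * by (auto simp: graftable_def)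
    then have "L2 # v \<in> join A B"
      "L2 # w = (L2 # v) @ replicate n L2 \<or> L2 # w = (L2 # v) @ [L1] @ replicate n L2"
      by auto
    then show ?thesis unfolding graftable_def by (metis join_not_empty(1))
  qed
qed

lemma join_subset_iff [simp]: "join A B \<subseteq> join A' B' \<longleftrightarrow> A \<subseteq> A' \<and> B \<subseteq> B'"
  by (auto simp: join_def)

lemma ball_join_iff:
  "(\<forall>w\<in>join A B. P w) \<longleftrightarrow> P [] \<and> (\<forall>w\<in>A. P (L1 # w)) \<and> (\<forall>w\<in>B. P (L2 # w))"
  by (auto simp: join_def)

lemma ball_Diff_iff: "(\<forall>w\<in>A - B. P w) \<longleftrightarrow> (\<forall>w\<in>A. w \<in> B \<or> P w)"
  by auto

lemma right_comb_iff: "right_comb t \<longleftrightarrow> (\<forall>w\<in>nodes t. graftable {} w)"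
  by (induction t) (simp_all add: ball_join_iff)

lemma grafts_iff: "grafts t t' \<longleftrightarrow> (nodes t, nodes t') \<in> G_U'"
proof -
  have "grafts t t' \<longleftrightarrow> nodes t \<subseteq> nodes t' \<and> (\<forall>w\<in>nodes t' - nodes t. graftable (nodes t) w)"
  proof (induction t arbitrary: t')
    case Leaf
    then show ?case by (simp add: right_comb_iff)
  next
    case (Node l r)
    show ?case
    proof (cases t')
      case (Node l' r')
      then show ?thesis
        using Node.IH[of l'] Node.IH[of r']
        by (auto simp: ball_Diff_iff ball_join_iff graftable_join_L1 graftable_join_L2)
    qed simp
  qed
  then show ?thesis by (simp add: G_U'_iff trees_eq_range_nodes)
qed

lemma grafts_size_le: "grafts t t' \<Longrightarrow> size t \<le> size t'"
proof (induction t arbitrary: t')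
  case (Node l r)
  then show ?case by (fastforce intro: add_mono)
qed simp


subsection \<open>The graph \<open>G_D\<close>\<close>

text \<open>The increasing enumeration of \<open>r_set\<close>. A nonempty right subtree keeps the
  root out of \<open>R_set\<close> and the left subtree out of \<open>E_set\<close>; over an empty
  one the root comes first and the left subtree contributes all of its own list.\<close>

primrec r_list :: "btree \<Rightarrow> word list" where
  "r_list Leaf = []"
| "r_list (Node l r) =
     (if r = Leaf then [] # map ((#) L1) (r_list l) else map ((#) L2) (r_list r))"

text \<open>The map \<open>D\<^sub>j\<close> made total: if \<open>j\<close> exceeds the length of
  \<open>r_list\<close>, all listed nodes are removed. Definedness is therefore recorded separately
  by a bound on \<open>j\<close>.\<close>

primrec prune :: "btree \<Rightarrow> nat \<Rightarrow> btree" where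
  "prune Leaf j = Leaf"
| "prune (Node l r) j =
     (if r = Leaf then (case j of 0 \<Rightarrow> Node l r | Suc k \<Rightarrow> prune l k) else Node l (prune r j))"

lemma prune_0 [simp]: "prune t 0 = t"
  by (induction t) auto

lemma size_prune: "j \<le> length (r_list t) \<Longrightarrow> size (prune t j) + j = size t"
proof (induction t arbitrary: j)
  case (Node l r)
  then show ?case
    using Node.IH(1)[of "j - 1"] Node.IH(2)[of j] by (cases j) (auto split: if_splits)
qed simp

lemma Nil_in_r_set_iff: "[] \<in> r_set T \<longleftrightarrow> [] \<in> T \<and> [L2] \<notin> T"
  by (auto simp: r_set_def E_set_def R_set_def)

text \<open>The factorization with \<open>v = []\<close> yields \<open>[] \<notin> B\<close>; all
  others come from factorizations of \<open>w\<close>.\<close>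

lemma L1_in_r_set_join_iff: "L1 # w \<in> r_set (join A B) \<longleftrightarrow> [] \<notin> B \<and> w \<in> r_set A"
proof -
  have "(\<forall>v w'. L1 # w = v @ L1 # w' \<longrightarrow> v @ [L2] \<notin> join A B) \<longleftrightarrow>
      [] \<notin> B \<and> (\<forall>v w'. w = v @ L1 # w' \<longrightarrow> v @ [L2] \<notin> A)"
    by (subst all_word_iff) (auto simp: Cons_eq_append_conv)
  then show ?thesis by (auto simp: r_set_def E_set_def R_set_def)
qed

lemma L2_in_r_set_join_iff: "L2 # w \<in> r_set (join A B) \<longleftrightarrow> w \<in> r_set B"
proof -
  have "(\<forall>v w'. L2 # w = v @ L1 # w' \<longrightarrow> v @ [L2] \<notin> join A B) \<longleftrightarrow>
      (\<forall>v w'. w = v @ L1 # w' \<longrightarrow> v @ [L2] \<notin> B)"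
    by (subst all_word_iff) (auto simp: Cons_eq_append_conv)
  then show ?thesis by (auto simp: r_set_def E_set_def R_set_def)
qed

lemma r_set_empty [simp]: "r_set {} = {}"
  by (simp add: r_set_def R_set_def)

lemma set_r_list: "set (r_list t) = r_set (nodes t)"
proof (induction t)
  case (Node l r)
  show ?case
    by (rule word_set_eqI)
      (auto simp: Node.IH Nil_in_r_set_iff L1_in_r_set_join_iff L2_in_r_set_join_iff)
qed simp

lemma sorted_r_list: "sorted_wrt strict_prefix (r_list t)"
  by (induction t) (auto simp: sorted_wrt_map)

lemma distinct_r_list: "distinct (r_list t)"
  by (induction t) (auto simp: distinct_map)

lemma card_r_set [simp]: "card (r_set (nodes t)) = length (r_list t)"
  using distinct_card[OF distinct_r_list] by (simp add: set_r_list)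

text \<open>In an increasing chain the prefixes of entry \<open>i\<close> are the entries up to
  \<open>i\<close>. This is the rank in \<open>r_node\<close>, which counts from 1 while list
  positions count from 0.\<close>

lemma card_prefixes_sorted:
  assumes "sorted_wrt strict_prefix xs" "i < length xs"
  shows "card {v \<in> set xs. prefix v (xs ! i)} = Suc i"
proof -
  have le: "prefix (xs ! k) (xs ! i) \<longleftrightarrow> k \<le> i" if "k < length xs" for k
  proof (cases "k \<le> i")
    case True
    then show ?thesis
      using sorted_wrt_nth_less[OF assms(1), of k i] assms(2)
      by (cases "k = i") (auto simp: strict_prefix_def)
  next
    case False
    then show ?thesis
      using sorted_wrt_nth_less[OF assms(1), of i k] that
      by (auto simp: strict_prefix_def dest: prefix_order.antisym)
  qed
  have "{v \<in> set xs. prefix v (xs ! i)} = (!) xs ` {..i}"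
  proof (intro equalityI subsetI)
    fix v assume "v \<in> {v \<in> set xs. prefix v (xs ! i)}"
    then obtain k where "k < length xs" "v = xs ! k" "prefix (xs ! k) (xs ! i)"
      by (auto simp: in_set_conv_nth)
    then show "v \<in> (!) xs ` {..i}" using le by simp
  next
    fix v assume "v \<in> (!) xs ` {..i}"
    then show "v \<in> {v \<in> set xs. prefix v (xs ! i)}" using assms(2) le by auto
  qed
  moreover have "inj_on ((!) xs) {..i}"
  proof (rule linorder_inj_onI')
    fix k m assume "k \<in> {..i}" "m \<in> {..i}" "k < m"
    then have "strict_prefix (xs ! k) (xs ! m)"
      using sorted_wrt_nth_less[OF assms(1)] assms(2) by simp
    then show "xs ! k \<noteq> xs ! m" by auto
  qed
  ultimately show ?thesis by (simp add: card_image)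
qed

lemma r_node_nodes:
  assumes "i < length (r_list t)"
  shows "r_node (nodes t) (Suc i) = r_list t ! i"
  unfolding r_node_def set_r_list[symmetric]
proof (rule the_equality)
  show "r_list t ! i \<in> set (r_list t) \<and>
      card {v \<in> set (r_list t). prefix v (r_list t ! i)} = Suc i"
    using assms card_prefixes_sorted[OF sorted_r_list] by simp
next
  fix w
  assume w: "w \<in> set (r_list t) \<and> card {v \<in> set (r_list t). prefix v w} = Suc i"
  then obtain k where k: "k < length (r_list t)" "w = r_list t ! k"
    by (auto simp: in_set_conv_nth)
  then show "w = r_list t ! i"
    using w card_prefixes_sorted[OF sorted_r_list k(1)] by simp
qed

text \<open>\<open>foldr\<close> treats the last entry first, matching the removal of the deepest
  node first.\<close>

lemma remove_nodes_eq_foldr: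
  "remove_nodes u j T = foldr (\<lambda>w T. remove_node T w) (map (\<lambda>i. u (Suc i)) [0..<j]) T"
  by (induction j arbitrary: T) simp_all

lemma remove_node_join_Nil: "remove_node (join A {}) [] = A"
  by (auto simp: remove_node_def subtree_at_def)

lemma remove_node_join_L1: "remove_node (join A B) (L1 # w) = join (remove_node A w) B"
  by (rule word_set_eqI) (auto simp: remove_node_def subtree_at_def)

lemma remove_node_join_L2: "remove_node (join A B) (L2 # w) = join A (remove_node B w)"
  by (rule word_set_eqI) (auto simp: remove_node_def subtree_at_def)

lemma foldr_remove_node_join_L1:
  "foldr (\<lambda>w T. remove_node T w) (map ((#) L1) ws) (join A B) =
     join (foldr (\<lambda>w T. remove_node T w) ws A) B"
  by (induction ws) (simp_all add: remove_node_join_L1)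

lemma foldr_remove_node_join_L2:
  "foldr (\<lambda>w T. remove_node T w) (map ((#) L2) ws) (join A B) =
     join A (foldr (\<lambda>w T. remove_node T w) ws B)"
  by (induction ws) (simp_all add: remove_node_join_L2)

text \<open>Over an empty right subtree the root is removed last, after the removals inside the left
  subtree, and what remains is the pruned left subtree. So words fixed in the original tree still
  address the right nodes.\<close>

lemma foldr_remove_node_r_list:
  "foldr (\<lambda>w T. remove_node T w) (take j (r_list t)) (nodes t) = nodes (prune t j)"
proof (induction t arbitrary: j)
  case (Node l r)
  then show ?case
    by (cases j) (auto simp: take_map foldr_remove_node_join_L1 foldr_remove_node_join_L2
        remove_node_join_Nil simp del: foldr_map)
qed simp

lemma r_remove_nodes:
  assumes "j \<le> length (r_list t)"
  shows "r_remove (nodes t) j = nodes (prune t j)"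
proof -
  have "map (\<lambda>i. r_node (nodes t) (Suc i)) [0..<j] = take j (r_list t)"
    using assms by (intro nth_equalityI) (auto simp: r_node_nodes)
  then show ?thesis
    by (simp add: r_remove_def remove_nodes_eq_foldr foldr_remove_node_r_list del: foldr_map)
qed

lemma G_D_iff: "(nodes t, nodes t') \<in> G_D j \<longleftrightarrow> j \<le> length (r_list t') \<and> t = prune t' j"
  by (auto simp: G_D_def trees_eq_range_nodes r_remove_nodes)


subsection \<open>Counting\<close>

text \<open>Its cardinality is the number \<open>n\<^sub>j t t'\<close>.\<close>

definition preimages :: "nat \<Rightarrow> btree \<Rightarrow> btree \<Rightarrow> btree set" where
  "preimages j t t' = {t''. grafts t t'' \<and> j \<le> length (r_list t'') \<and> prune t'' j = t'}"

text \<open>The condition under which \<open>s\<^sub>j t t'\<close> is 1, including that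
  \<open>D\<^sub>j t\<close> is defined.\<close>

definition prune_grafts :: "nat \<Rightarrow> btree \<Rightarrow> btree \<Rightarrow> bool" where
  "prune_grafts j t t' \<longleftrightarrow> j \<le> length (r_list t) \<and> grafts (prune t j) t'"

lemma prune_grafts_0 [simp]: "prune_grafts 0 t t' \<longleftrightarrow> grafts t t'"
  by (simp add: prune_grafts_def)

lemma prune_grafts_Suc_Node_Leaf [simp]:
  "prune_grafts (Suc j) (Node l Leaf) t' \<longleftrightarrow> prune_grafts j l t'"
  by (simp add: prune_grafts_def)

lemma prune_grafts_Node:
  "r \<noteq> Leaf \<Longrightarrow> prune_grafts j (Node l r) t' \<longleftrightarrow>
     (\<exists>l' r'. t' = Node l' r' \<and> grafts l l' \<and> prune_grafts j r r')"
  by (auto simp: prune_grafts_def)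

lemma preimages_0: "preimages 0 t t' = (if grafts t t' then {t'} else {})"
  by (auto simp: preimages_def)

text \<open>In a nonempty right comb only the last node is removable, and removing it leaves a right
  comb.\<close>

lemma right_comb_prune:
  "right_comb t \<Longrightarrow> Suc j \<le> length (r_list t) \<Longrightarrow> j = 0 \<and> right_comb (prune t (Suc j))"
  by (induction t) (auto split: if_splits)

text \<open>On right combs this inverts the removal of the last node.\<close>

primrec extend_comb :: "btree \<Rightarrow> btree" where
  "extend_comb Leaf = Node Leaf Leaf"
| "extend_comb (Node l r) = Node l (extend_comb r)"

lemma extend_comb_not_Leaf [simp]: "extend_comb t \<noteq> Leaf"
  by (cases t) auto

lemma preimages_Suc_Leaf:
  "preimages (Suc j) Leaf t' = (if j = 0 \<and> right_comb t' then {extend_comb t'} else {})"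
proof -
  have 1: "extend_comb (prune t (Suc 0)) = t"
    if "right_comb t" "Suc 0 \<le> length (r_list t)" for t
    using that by (induction t) (auto split: if_splits)
  have 2: "right_comb (extend_comb t') \<and> length (r_list (extend_comb t')) = Suc 0 \<and>
      prune (extend_comb t') (Suc 0) = t'" if "right_comb t'"
    using that by (induction t') auto
  show ?thesis
  proof (rule set_eqI)
    fix t
    show "t \<in> preimages (Suc j) Leaf t' \<longleftrightarrow>
        t \<in> (if j = 0 \<and> right_comb t' then {extend_comb t'} else {})"
      using 1[of t] 2 right_comb_prune[of t j] by (auto simp: preimages_def)
  qed
qed

text \<open>The two parts are the trees whose right subtree is empty and those whose right subtree
  is not: \<open>preimages (Suc j) r r'\<close> does not contain the empty tree.\<close>

lemma preimages_Suc_Node: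
  "preimages (Suc j) (Node l r) t' =
     (if r = Leaf then (\<lambda>l''. Node l'' Leaf) ` preimages j l t' else {}) \<union>
     (case t' of Leaf \<Rightarrow> {}
      | Node l' r' \<Rightarrow> if grafts l l' then Node l' ` preimages (Suc j) r r' else {})"
  (is "?L = ?R")
proof (rule set_eqI)
  fix t''
  \<comment> \<open>An empty right subtree of \<open>t''\<close> can only arise from an empty
    \<open>r\<close>.\<close>
  have grafts_Leaf: "grafts r Leaf \<longleftrightarrow> r = Leaf" by (cases r) auto
  show "t'' \<in> ?L \<longleftrightarrow> t'' \<in> ?R"
  proof (cases t'')
    case Leaf
    then show ?thesis by (auto simp: preimages_def split: btree.split)
  next
    case (Node l'' r'')
    then show ?thesis
      by (cases "r'' = Leaf"; cases t')
        (auto simp: preimages_def grafts_Leaf image_iff)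
  qed
qed

text \<open>For \<open>r \<noteq> Leaf\<close> both sides reduce to \<open>r\<close>. For
  \<open>r = Leaf\<close> and \<open>j = Suc k\<close>, the preimages with empty right subtree are
  counted by \<open>l\<close> at index \<open>k\<close>, and \<open>prune_grafts\<close> shifts its
  index in the same way. The guard \<open>0 < j\<close> keeps the truncated \<open>j - 1\<close>
  from counting index 0 twice.\<close>

lemma card_preimages:
  "finite (preimages j t t') \<and>
     card (preimages j t t') =
       of_bool (prune_grafts j t t') + of_bool (0 < j \<and> prune_grafts (j - 1) t t')"
proof (induction t arbitrary: j t')
  case Leaf
  then show ?case
    by (cases j) (auto simp: preimages_0 preimages_Suc_Leaf prune_grafts_def)
next
  case (Node l r)
  show ?case
  proof (cases j)
    case 0
    then show ?thesis by (auto simp: preimages_0 prune_grafts_def)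
  next
    case (Suc k)
    define A where "A = (if r = Leaf then (\<lambda>l''. Node l'' Leaf) ` preimages k l t' else {})"
    define B where "B = (case t' of Leaf \<Rightarrow> {}
      | Node l' r' \<Rightarrow> if grafts l l' then Node l' ` preimages (Suc k) r r' else {})"
    have eq: "preimages j (Node l r) t' = A \<union> B"
      unfolding Suc A_def B_def by (rule preimages_Suc_Node)
    have fin: "finite A" "finite B"
      using Node.IH by (auto simp: A_def B_def split: btree.split)
    have "A \<inter> B = {}"
      by (auto simp: A_def B_def preimages_def split: btree.splits if_splits)
    then have card: "card (preimages j (Node l r) t') = card A + card B"
      by (simp add: eq card_Un_disjoint fin)
    have cardA: "card A = (if r = Leaf then card (preimages k l t') else 0)"
      by (auto simp: A_def card_image inj_on_def)
    have cardB: "card B = (case t' of Leaf \<Rightarrow> 0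
      | Node l' r' \<Rightarrow> if grafts l l' then card (preimages (Suc k) r r') else 0)"
      by (auto simp: B_def card_image inj_on_def split: btree.split)
    have "card A + card B =
        of_bool (prune_grafts (Suc k) (Node l r) t') + of_bool (prune_grafts k (Node l r) t')"
    proof (cases "r = Leaf")
      case True
      \<comment> \<open>Only \<open>k = 0\<close> contributes here, supplying the term at index 0
        that the count for \<open>l\<close> lacks.\<close>
      have "card B = of_bool (k = 0 \<and> grafts (Node l r) t')"
        by (cases t') (simp_all add: cardB True preimages_Suc_Leaf)
      then show ?thesis
        using Node.IH(1)[of k t'] by (cases k) (simp_all add: cardA True)
    next
      case False
      show ?thesis
      proof (cases t')
        case Leaf
        then show ?thesis by (simp add: cardA cardB False prune_grafts_Node)
      next
        case (Node l' r')
        then show ?thesis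
          using Node.IH(2)[of "Suc k" r'] by (simp add: cardA cardB False prune_grafts_Node)
      qed
    qed
    then show ?thesis using card eq fin Suc by simp
  qed
qed

section \<open>Cardinalities of \<open>N'\<close> and \<open>S'_tilde\<close>\<close>

lemma G_U'i_iff:
  "(nodes t, nodes t') \<in> G_U'i i \<longleftrightarrow> grafts t t' \<and> size t + i = size t'"
  by (simp add: G_U'i_def grafts_iff)

lemma Collect_trees_eq:
  "{f T |T. T \<in> trees \<and> P T} = (\<lambda>t. f (nodes t)) ` {t. P (nodes t)}"
  by (auto simp: trees_eq_range_nodes)

text \<open>Eliminating the size of \<open>t''\<close> from the two size equations leaves a balance
  that does not involve \<open>t''\<close>.\<close>

lemma N'_nodes:
  "N' i j (nodes t) (nodes t') =
     (\<lambda>t''. ((nodes t, nodes t''), (nodes t', nodes t''))) `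
       {t'' \<in> preimages j t t'. size t + i = size t' + j}"
proof -
  have "{u. (nodes t, nodes u) \<in> G_U'i i \<and> (nodes t', nodes u) \<in> G_D j} =
      {u \<in> preimages j t t'. size t + i = size t' + j}"
    using size_prune by (auto simp: G_D_iff G_U'i_iff preimages_def)
  then show ?thesis
    by (simp add: N'_def Collect_trees_eq)
qed

text \<open>The middle tree is forced to be \<open>prune t j\<close>, and the size balance is the
  same as for \<open>N'\<close>.\<close>

lemma S'_nodes:
  "S' j i (nodes t) (nodes t') =
     (if prune_grafts j t t' \<and> size t + i = size t' + j
      then {((nodes (prune t j), nodes t), (nodes (prune t j), nodes t'))} else {})"
proof -
  have "size t + i = size t' + j \<longleftrightarrow> size (prune t j) + i = size t'" if "j \<le> length (r_list t)"
    using size_prune[OF that] by linarith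
  then have "{u. (nodes u, nodes t) \<in> G_D j \<and> (nodes u, nodes t') \<in> G_U'i i} =
      (if prune_grafts j t t' \<and> size t + i = size t' + j then {prune t j} else {})"
    by (auto simp: G_D_iff G_U'i_iff prune_grafts_def)
  then show ?thesis
    by (simp add: S'_def Collect_trees_eq)
qed

lemma card_N'_nodes:
  "card (N' i j (nodes t) (nodes t')) =
     (if size t + i = size t' + j then card (preimages j t t') else 0)"
  by (auto simp: N'_nodes card_image inj_on_def)

text \<open>The summands \<open>k = 0\<close> and \<open>k = 1\<close> match the two terms of
  \<open>card_preimages\<close>; lowering \<open>i\<close> and \<open>j\<close> together preserves
  the balance.\<close>

lemma card_S'_tilde_nodes:
  "card (S'_tilde j i (nodes t) (nodes t')) =
     (if size t + i = size t' + j then card (preimages j t t') else 0)"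
proof -
  have fin: "finite (S' j' i' (nodes t) (nodes t'))" for j' i'
    by (simp add: S'_nodes)
  have card_S': "card (S' j' i' (nodes t) (nodes t')) =
      of_bool (prune_grafts j' t t' \<and> size t + i' = size t' + j')" for j' i'
    by (simp add: S'_nodes)
  have sum: "card (S'_tilde j i (nodes t) (nodes t')) =
      (\<Sum>k\<in>{0..min 1 (min i j)}. card (S' (j - k) (i - k) (nodes t) (nodes t')))"
    unfolding S'_tilde_def by (rule card_SigmaI) (auto simp: fin)
  show ?thesis
  proof (cases "0 < i \<and> 0 < j")
    case True
    then have "{0..min 1 (min i j)} = {0, 1}" by auto
    then have "card (S'_tilde j i (nodes t) (nodes t')) =
        card (S' j i (nodes t) (nodes t')) + card (S' (j - 1) (i - 1) (nodes t) (nodes t'))"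
      by (simp only: sum) simp
    moreover have "size t + (i - 1) = size t' + (j - 1) \<longleftrightarrow> size t + i = size t' + j"
      using True by linarith
    ultimately show ?thesis
      using True card_preimages[of j t t'] by (simp only: card_S') simp
  next
    case False
    \<comment> \<open>Here \<open>i = 0\<close>, so removing \<open>j - 1\<close> nodes from
      \<open>t\<close> leaves one node more than \<open>t'\<close> has, and grafting cannot lose
      it.\<close>
    have "\<not> prune_grafts (j - 1) t t'" if "size t + i = size t' + j" "0 < j"
    proof
      assume "prune_grafts (j - 1) t t'"
      then have "size (prune t (j - 1)) \<le> size t'" "size (prune t (j - 1)) + (j - 1) = size t"
        using grafts_size_le size_prune by (auto simp: prune_grafts_def)
      then show False using that False by linarith
    qed
    then have "card (preimages j t t') = of_bool (prune_grafts j t t')"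
      if "size t + i = size t' + j"
      using that card_preimages[of j t t'] by auto
    moreover have "{0..min 1 (min i j)} = {0}" using False by auto
    then have "card (S'_tilde j i (nodes t) (nodes t')) = card (S' j i (nodes t) (nodes t'))"
      by (simp only: sum) simp
    ultimately show ?thesis by (simp add: card_S')
  qed
qed

theorem lemma4p12:
  fixes T T' :: "word set" and i j :: nat
  assumes "T \<in> trees" and "T' \<in> trees"
  shows "\<exists>f. bij_betw f (N' i j T T') (S'_tilde j i T T')"
proof -
  obtain t t' where T: "T = nodes t" "T' = nodes t'"
    using assms unfolding trees_eq_range_nodes by (elim imageE)
  have "finite (N' i j T T')"
    using card_preimages by (simp add: T N'_nodes)
  moreover have "finite (S'_tilde j i T T')"
    unfolding S'_tilde_def by (intro finite_SigmaI) (simp_all add: T S'_nodes)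
  ultimately show ?thesis
    by (rule finite_same_card_bij) (simp add: T card_N'_nodes card_S'_tilde_nodes)
qed

end
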